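(* Let $\Omega,\Omega_1,\ldots,\Omega_m$ be nonempty closed convex subsets of $\mathbb{R}^n$, at least one of which is bounded, and let $\bar p>0$. For $x,y\in\mathbb{R}^n$ let $$\mathcal{D}(x,\bar p):=\bar p\ln\sum_{i=1}^m\exp\left(\frac{\sqrt{d(x;\Omega_i)^2+\bar p^2}}{\bar p}\right),\qquad \mathcal{G}(x,y,\bar p):=\bar p\ln\sum_{i=1}^m\exp\left(\frac{\sqrt{\|x-\Pi(y;\Omega_i)\|^2+\bar p^2}}{\bar p}\right),$$ and define the algorithm map $\psi:\Omega\to\Omega$ by $\psi(x):=\arg\min_{y\in\Omega}\mathcal{G}(y,x,\bar p)$. Then the function $\mathcal{D}(\cdot,\bar p)$ and the map $\psi:\Omega\to\Omega$ satisfy the following conditions. (i) For any $x_0\in\Omega$, the level set $\mathcal{L}(x_0):=\{x\in\Omega\mid \mathcal{D}(x,\bar p)\le\mathcal{D}(x_0,\bar p)\}$ is compact. (ii) $\psi$ is continuous on $\Omega$. (iii) $\mathcal{D}(\psi(x),\bar p)<\mathcal{D}(x,\bar p)$ whenever $x\in\Omega$ and $x\neq\psi(x)$. (iv) Any fixed point $\bar x$ of $\psi$ is a minimizer of $\mathcal{D}(\cdot,\bar p)$ on $\Omega$.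
   Context: $\mathbb{R}^n$ carries the Euclidean norm $\|\cdot\|$. For a nonempty closed convex set $Q\subset\mathbb{R}^n$, $d(x;Q):=\inf\{\|x-q\|\mid q\in Q\}$ and $\Pi(x;Q)$ is the Euclidean projection of $x$ onto $Q$, i.e. the unique $q\in Q$ with $\|x-q\|=d(x;Q)$. The notation $\arg\min_{y\in\Omega}\mathcal{G}(y,x,\bar p)$ denotes the unique minimizer of $\mathcal{G}(\cdot,x,\bar p)$ over $\Omega$. *)

theory Defs
  imports "HOL-Analysis.Analysis"
begin

text \<open>
  The target sets are \<open>T 1, \<dots>, T m\<close>. For a nonempty set \<open>Q\<close>, \<^term>\<open>infdist x Q\<close> is the
  distance \<open>d(x; Q)\<close>; for a nonempty closed convex \<open>Q\<close>, \<^term>\<open>closest_point Q x\<close> is the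
  Euclidean projection \<open>\<Pi>(x; Q)\<close>.
\<close>

definition smooth_dist :: "nat \<Rightarrow> (nat \<Rightarrow> (real ^ 'n) set) \<Rightarrow> real ^ 'n \<Rightarrow> real \<Rightarrow> real" where
  "smooth_dist m T x p =
     p * ln (\<Sum>i=1..m. exp (sqrt ((infdist x (T i))\<^sup>2 + p\<^sup>2) / p))"

definition smooth_major ::
  "nat \<Rightarrow> (nat \<Rightarrow> (real ^ 'n) set) \<Rightarrow> real ^ 'n \<Rightarrow> real ^ 'n \<Rightarrow> real \<Rightarrow> real" where
  "smooth_major m T x y p =
     p * ln (\<Sum>i=1..m. exp (sqrt ((norm (x - closest_point (T i) y))\<^sup>2 + p\<^sup>2) / p))"

text \<open>
  The argument that is minimized over is the first one of \<^const>\<open>smooth_major\<close>; the base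
  point \<open>x\<close> enters only through the projections. The description operator is meaningful only
  where the minimizer exists and is unique.
\<close>

definition alg_map ::
  "(real ^ 'n) set \<Rightarrow> nat \<Rightarrow> (nat \<Rightarrow> (real ^ 'n) set) \<Rightarrow> real \<Rightarrow> real ^ 'n \<Rightarrow> real ^ 'n" where
  "alg_map \<Omega> m T p x = (THE y. is_arg_min (\<lambda>y. smooth_major m T y x p) (\<lambda>y. y \<in> \<Omega>) y)"

end

theory Submission
  imports Defs
begin

section \<open>The penalty: growth, convexity and local comparison\<close>

definition pen :: "real \<Rightarrow> 'a::euclidean_space \<Rightarrow> real" where
  "pen p v = exp (sqrt ((norm v)\<^sup>2 + p\<^sup>2) / p)"

lemma pen_pos: "pen p v > 0"
  by (simp add: pen_def)

lemma pen_mono: "p > 0 \<Longrightarrow> norm v \<le> norm w \<Longrightarrow> pen p v \<le> pen p w"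
  by (simp add: pen_def divide_right_mono power_mono)

lemma continuous_on_pen [continuous_intros]:
  "continuous_on S f \<Longrightarrow> p \<noteq> 0 \<Longrightarrow> continuous_on S (\<lambda>x. pen p (f x))"
  unfolding pen_def by (intro continuous_intros) auto

text \<open>Follows from \<open>exp u >= 1 + u\<close>, since the exponent already dominates
  \<open>norm v / p\<close>. This coercivity bound is what later confines minimizers and sublevel
  sets to balls.\<close>

lemma norm_le_pen:
  assumes "p > 0"
  shows "norm v \<le> p * pen p v"
proof -
  have "norm v / p \<le> sqrt ((norm v)\<^sup>2 + p\<^sup>2) / p"
    using assms by (intro divide_right_mono real_le_rsqrt) auto
  also have "\<dots> \<le> pen p v"
    unfolding pen_def using exp_ge_add_one_self[of "sqrt ((norm v)\<^sup>2 + p\<^sup>2) / p"] by linarith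
  finally show ?thesis
    using assms by (simp add: field_simps)
qed

text \<open>\<^term>\<open>sqrt ((norm v)\<^sup>2 + p\<^sup>2)\<close> is the norm of the pair \<^term>\<open>(v, p)\<close>, and two such pairs are
  parallel only if they are equal; this gives strict convexity.\<close>

lemma pen_strictly_convex:
  assumes p: "p > 0" and "v \<noteq> w" and s: "0 < s" and t: "0 < t" and st: "s + t = 1"
  shows "pen p (s *\<^sub>R v + t *\<^sub>R w) < s * pen p v + t * pen p w"
proof -
  have pen_eq: "pen p u = exp (norm (u, p) / p)" for u :: 'a
    by (simp add: pen_def norm_Pair)
  have pair: "(s *\<^sub>R v + t *\<^sub>R w, p) = s *\<^sub>R (v, p) + t *\<^sub>R (w, p)"
    using st by (simp flip: distrib_right)
  have "norm (s *\<^sub>R (v, p) + t *\<^sub>R (w, p)) \<noteq> norm (s *\<^sub>R (v, p)) + norm (t *\<^sub>R (w, p))"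
  proof
    assume "norm (s *\<^sub>R (v, p) + t *\<^sub>R (w, p)) = norm (s *\<^sub>R (v, p)) + norm (t *\<^sub>R (w, p))"
    \<comment> \<open>Equality in the triangle inequality forces the two scaled pairs to be
      parallel.\<close>
    then have "(s * norm (v, p)) *\<^sub>R t *\<^sub>R (w, p) = (t * norm (w, p)) *\<^sub>R s *\<^sub>R (v, p)"
      using s t unfolding norm_triangle_eq by (simp del: scaleR_Pair scaleR_scaleR)
    then have *: "(s * t * norm (v, p)) *\<^sub>R (w, p) = (s * t * norm (w, p)) *\<^sub>R (v, p)"
      by (simp add: mult_ac)
    \<comment> \<open>Comparing second components, both multiples of \<open>p\<close>, shows that
      the two scalars agree; they are nonzero and cancel.\<close>
    then have "s * t * norm (v, p) * p = s * t * norm (w, p) * p"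
      by simp
    then have "norm (v, p) = norm (w, p)"
      using s t p by simp
    moreover have "norm (w, p) \<noteq> 0"
      using p by (simp add: zero_prod_def)
    ultimately have "w = v"
      using * s t by simp
    with \<open>v \<noteq> w\<close> show False by simp
  qed
  then have "norm (s *\<^sub>R (v, p) + t *\<^sub>R (w, p)) < s * norm (v, p) + t * norm (w, p)"
    using norm_triangle_ineq[of "s *\<^sub>R (v, p)" "t *\<^sub>R (w, p)"] s t
    by (simp del: scaleR_Pair)
  then have "pen p (s *\<^sub>R v + t *\<^sub>R w) < exp (s * (norm (v, p) / p) + t * (norm (w, p) / p))"
    using p by (simp add: pen_eq pair divide_strict_right_mono flip: add_divide_distrib del: scaleR_Pair)
  also have "\<dots> \<le> s * pen p v + t * pen p w"
    using convex_onD[OF exp_convex, of t "norm (v, p) / p" "norm (w, p) / p"] s t st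
    by (simp add: pen_eq eq_diff_eq[symmetric])
  finally show ?thesis .
qed

lemma pen_convex:
  assumes "p > 0" "0 < s" "0 < t" "s + t = 1"
  shows "pen p (s *\<^sub>R v + t *\<^sub>R w) \<le> s * pen p v + t * pen p w"
proof (cases "v = w")
  case True
  then show ?thesis
    using assms by (simp flip: distrib_right scaleR_left_distrib)
next
  case False
  then show ?thesis
    using pen_strictly_convex[OF assms(1) False assms(2-4)] by simp
qed

text \<open>As a function of \<^term>\<open>(norm v)\<^sup>2\<close>, the penalty has logarithmic derivative at most
  \<^term>\<open>1 / (2 * p\<^sup>2)\<close>.\<close>

lemma pen_diff_le:
  assumes p: "p > 0" and le: "(norm v)\<^sup>2 - (norm w)\<^sup>2 \<le> e" "0 \<le> e"
  shows "pen p v * (1 - e / (2 * p\<^sup>2)) \<le> pen p w"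
proof -
  define a b where "a = sqrt ((norm v)\<^sup>2 + p\<^sup>2)" and "b = sqrt ((norm w)\<^sup>2 + p\<^sup>2)"
  have ab: "a \<ge> p" "b \<ge> p"
    using p by (auto simp: a_def b_def real_le_rsqrt)
  have "(a - b) * (a + b) = (norm v)\<^sup>2 - (norm w)\<^sup>2"
    by (simp add: a_def b_def square_diff_square_factored[symmetric] mult.commute[of "_ - _"]
        flip: power2_eq_square)
  then have *: "(a - b) * (a + b) \<le> e"
    using le by simp
  \<comment> \<open>Divide by \<open>a + b\<close>, which is at least \<open>2 * p\<close>. That
    bound helps only if \<open>a > b\<close>; otherwise \<open>0 \<le> e\<close> suffices.\<close>
  have "a - b \<le> e / (2 * p)"
  proof (cases "a \<le> b")
    case True
    then have "a - b \<le> 0" by simp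
    also have "0 \<le> e / (2 * p)" using p le by simp
    finally show ?thesis .
  next
    case False
    then have "(a - b) * (2 * p) \<le> (a - b) * (a + b)"
      using ab by (intro mult_left_mono) auto
    then show ?thesis
      using * p by (simp add: field_simps)
  qed
  then have "(a - b) / p \<le> e / (2 * p\<^sup>2)"
    using p divide_right_mono[of "a - b" "e / (2 * p)" p] by (simp add: power2_eq_square)
  then have "1 - e / (2 * p\<^sup>2) \<le> exp (b / p - a / p)"
    using exp_ge_add_one_self[of "b / p - a / p"] unfolding diff_divide_distrib by linarith
  then have "exp (a / p) * (1 - e / (2 * p\<^sup>2)) \<le> exp (a / p) * exp (b / p - a / p)"
    by (intro mult_left_mono) auto
  then show ?thesis
    by (simp add: pen_def a_def b_def flip: exp_add)
qed

section \<open>Projections onto closed convex sets\<close>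

lemma infdist_eq_dist_closest_point:
  fixes S :: "'a::euclidean_space set"
  assumes "closed S" "S \<noteq> {}"
  shows "infdist x S = norm (x - closest_point S x)"
  using setdist_closest_point[OF assms, of x] assms
  by (simp add: infdist_eq_setdist dist_norm)

lemma norm_diff_closest_point_le:
  fixes S :: "'a::euclidean_space set"
  assumes "closed S" "y \<in> S"
  shows "norm (x - closest_point S x) \<le> norm (x - y)"
  using closest_point_le[OF assms, of x] by (simp add: dist_norm)

text \<open>The projection \<open>q\<close> of \<open>x\<close> sees every point of \<open>S\<close>
  at an obtuse angle from \<open>x - q\<close>; completing the square turns this into the bound.
  Using the projection of a nearby \<open>x\<close> in place of that of \<open>w\<close> thus costs
  only a second-order term.\<close>

lemma norm_diff_closest_point_sq_le:
  fixes S :: "'a::euclidean_space set"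
  assumes "closed S" "convex S" "S \<noteq> {}"
  shows "(norm (w - closest_point S x))\<^sup>2 - (norm (w - closest_point S w))\<^sup>2 \<le> (norm (w - x))\<^sup>2"
proof -
  define q r where "q = closest_point S x" and "r = closest_point S w"
  have "r \<in> S"
    using assms by (simp add: r_def closest_point_in_set)
  then have "inner (x - q) (r - q) \<le> 0"
    unfolding q_def using assms by (intro closest_point_dot)
  moreover have "0 \<le> (norm ((w - x) - (r - q)))\<^sup>2"
    by simp
  moreover have "(norm (w - q))\<^sup>2 - (norm (w - r))\<^sup>2
    = (norm (w - x))\<^sup>2 + 2 * inner (x - q) (r - q) - (norm ((w - x) - (r - q)))\<^sup>2"
    by (simp add: power2_norm_eq_inner inner_diff_left inner_diff_right inner_commute algebra_simps)
  ultimately show ?thesis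
    unfolding q_def r_def by linarith
qed

section \<open>Surrogate and energy\<close>

locale smoothed_targets =
  fixes \<Omega> :: "'a::euclidean_space set"
    and I :: "nat set"
    and T :: "nat \<Rightarrow> 'a set"
    and p :: real
  assumes fin: "finite I" and ne: "I \<noteq> {}"
    and \<Omega>: "\<Omega> \<noteq> {}" "closed \<Omega>" "convex \<Omega>"
    and T: "\<And>i. i \<in> I \<Longrightarrow> T i \<noteq> {}" "\<And>i. i \<in> I \<Longrightarrow> closed (T i)" "\<And>i. i \<in> I \<Longrightarrow> convex (T i)"
    and p: "p > 0"
begin

text \<open>This is \<open>exp (smooth_major m T y x p / p)\<close> for \<open>I = {1..m}\<close>.
  Since \<open>p * ln\<close> is increasing, dropping it keeps all comparisons and leaves a plain
  sum of penalties; \<open>energy\<close> is likewise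
  \<open>exp (smooth_dist m T x p / p)\<close>.\<close>

definition surrogate :: "'a \<Rightarrow> 'a \<Rightarrow> real" where
  "surrogate y x = (\<Sum>i\<in>I. pen p (y - closest_point (T i) x))"

definition energy :: "'a \<Rightarrow> real" where
  "energy x = surrogate x x"

lemma surrogate_pos: "surrogate y x > 0"
  unfolding surrogate_def using fin ne by (intro sum_pos pen_pos)

lemma energy_pos: "energy x > 0"
  by (simp add: energy_def surrogate_pos)

lemma pen_le_surrogate: "i \<in> I \<Longrightarrow> pen p (y - closest_point (T i) x) \<le> surrogate y x"
  unfolding surrogate_def using fin by (intro member_le_sum) (auto simp: pen_pos less_imp_le)

lemma norm_le_surrogate:
  assumes "i \<in> I"
  shows "norm (y - closest_point (T i) x) \<le> p * surrogate y x"
  using norm_le_pen[OF p, of "y - closest_point (T i) x"]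
    mult_left_mono[OF pen_le_surrogate[OF assms, of y x], of p] p
  by linarith

lemma continuous_on_surrogate [continuous_intros]:
  assumes "continuous_on S f" "continuous_on S g"
  shows "continuous_on S (\<lambda>x. surrogate (f x) (g x))"
  unfolding surrogate_def using p T assms
  by (auto intro!: continuous_intros
      continuous_on_compose2[OF continuous_on_closest_point[where t = UNIV]])

lemma continuous_on_energy: "continuous_on S energy"
  unfolding energy_def by (intro continuous_intros)

text \<open>With \<open>x\<close> fixed the projections are constants, so each summand is a
  translate of the strictly convex \<open>pen p\<close>.\<close>

lemma surrogate_strictly_convex:
  assumes "y \<noteq> z" "0 < s" "0 < t" "s + t = 1"
  shows "surrogate (s *\<^sub>R y + t *\<^sub>R z) x < s * surrogate y x + t * surrogate z x"
proof -
  have "s *\<^sub>R y + t *\<^sub>R z - c = s *\<^sub>R (y - c) + t *\<^sub>R (z - c)" for c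
  proof -
    have "c = s *\<^sub>R c + t *\<^sub>R c"
      using assms by (simp flip: scaleR_left_distrib)
    then show ?thesis by (simp add: algebra_simps)
  qed
  then show ?thesis
    unfolding surrogate_def sum_distrib_left sum.distrib[symmetric]
    using fin ne assms p by (intro sum_strict_mono) (auto intro!: pen_strictly_convex)
qed

text \<open>Majorization: the projection of \<open>x\<close> lies in \<open>T i\<close>, so it is no
  closer to \<open>y\<close> than the projection of \<open>y\<close> itself.\<close>

lemma energy_le_surrogate: "energy y \<le> surrogate y x"
  unfolding energy_def surrogate_def using T p
  by (intro sum_mono pen_mono norm_diff_closest_point_le) (auto simp: closest_point_in_set)

text \<open>A converse to the majorization with a quadratic loss, obtained termwise from
  \<open>pen_diff_le\<close> with \<open>e = (norm (w - x))^2\<close>.\<close>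

lemma surrogate_le_energy:
  "surrogate w x * (1 - (norm (w - x))\<^sup>2 / (2 * p\<^sup>2)) \<le> energy w"
  unfolding energy_def surrogate_def sum_distrib_right using T p
  by (intro sum_mono pen_diff_le norm_diff_closest_point_sq_le) auto

text \<open>The convex combination of the two projections stays in \<open>T i\<close> and so
  competes with the projection of the combined point; monotonicity and convexity of the penalty do
  the rest.\<close>

lemma energy_convex:
  assumes st: "0 < s" "0 < t" "s + t = 1"
  shows "energy (s *\<^sub>R x + t *\<^sub>R z) \<le> s * energy x + t * energy z"
  unfolding energy_def surrogate_def sum_distrib_left sum.distrib[symmetric]
proof (rule sum_mono)
  fix i assume i: "i \<in> I"
  let ?P = "closest_point (T i)"
  have "s *\<^sub>R ?P x + t *\<^sub>R ?P z \<in> T i"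
    using T[OF i] st by (intro convexD) (auto simp: closest_point_in_set)
  then have "norm (s *\<^sub>R x + t *\<^sub>R z - ?P (s *\<^sub>R x + t *\<^sub>R z))
      \<le> norm (s *\<^sub>R x + t *\<^sub>R z - (s *\<^sub>R ?P x + t *\<^sub>R ?P z))"
    using T[OF i] by (intro norm_diff_closest_point_le)
  also have "s *\<^sub>R x + t *\<^sub>R z - (s *\<^sub>R ?P x + t *\<^sub>R ?P z) = s *\<^sub>R (x - ?P x) + t *\<^sub>R (z - ?P z)"
    by (simp add: algebra_simps)
  finally have "pen p (s *\<^sub>R x + t *\<^sub>R z - ?P (s *\<^sub>R x + t *\<^sub>R z))
      \<le> pen p (s *\<^sub>R (x - ?P x) + t *\<^sub>R (z - ?P z))"
    using p by (intro pen_mono)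
  also have "\<dots> \<le> s * pen p (x - ?P x) + t * pen p (z - ?P z)"
    using p st by (intro pen_convex)
  finally show "pen p (s *\<^sub>R x + t *\<^sub>R z - ?P (s *\<^sub>R x + t *\<^sub>R z))
      \<le> s * pen p (x - ?P x) + t * pen p (z - ?P z)" .
qed

section \<open>The algorithm map: existence, uniqueness, continuity\<close>

abbreviation minimizes :: "'a \<Rightarrow> 'a \<Rightarrow> bool" where
  "minimizes x y \<equiv> is_arg_min (\<lambda>y. surrogate y x) (\<lambda>y. y \<in> \<Omega>) y"

lemma minimizes_unique:
  assumes "minimizes x y" "minimizes x z"
  shows "y = z"
proof (rule ccontr)
  assume "y \<noteq> z"
  then have "surrogate ((1/2) *\<^sub>R y + (1/2) *\<^sub>R z) x < 1/2 * surrogate y x + 1/2 * surrogate z x"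
    by (intro surrogate_strictly_convex) auto
  moreover have "(1/2) *\<^sub>R y + (1/2) *\<^sub>R z \<in> \<Omega>"
    using assms \<Omega> by (intro convexD) (auto simp: is_arg_min_linorder)
  ultimately show False
    using assms by (fastforce simp: is_arg_min_linorder)
qed

lemma minimizes_ex: "\<exists>y. minimizes x y"
proof -
  obtain i where i: "i \<in> I" using ne by auto
  obtain y0 where y0: "y0 \<in> \<Omega>" using \<Omega> by auto
  \<comment> \<open>By coercivity this sublevel set is compact, and points of \<Omega> outside it
    are worse than \<open>y0\<close>.\<close>
  define K where "K = {y \<in> \<Omega>. surrogate y x \<le> surrogate y0 x}"
  have "closed K"
    unfolding K_def Collect_conj_eq using \<Omega>
    by (intro closed_Int closed_Collect_le continuous_intros) auto
  moreover have "K \<subseteq> cball (closest_point (T i) x) (p * surrogate y0 x)"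
  proof
    fix y assume "y \<in> K"
    then have "p * surrogate y x \<le> p * surrogate y0 x"
      using p by (simp add: K_def)
    then show "y \<in> cball (closest_point (T i) x) (p * surrogate y0 x)"
      using norm_le_surrogate[OF i, of y x] by (simp add: dist_norm norm_minus_commute)
  qed
  ultimately have "compact K"
    using bounded_subset[OF bounded_cball] by (simp add: compact_eq_bounded_closed)
  moreover have "K \<noteq> {}"
    using y0 by (auto simp: K_def)
  ultimately obtain y where "y \<in> K" "\<And>z. z \<in> K \<Longrightarrow> surrogate y x \<le> surrogate z x"
    using continuous_attains_inf[of K "\<lambda>y. surrogate y x"]
      continuous_on_surrogate[OF continuous_on_id continuous_on_const] by blast
  then have "minimizes x y"
    unfolding is_arg_min_linorder K_def by (smt (verit) mem_Collect_eq)
  then show ?thesis ..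
qed

definition step :: "'a \<Rightarrow> 'a" where
  "step x = (THE y. minimizes x y)"

lemma minimizes_step: "minimizes x (step x)"
  unfolding step_def using minimizes_ex minimizes_unique theI'[of "minimizes x"] by blast

lemma step_in: "step x \<in> \<Omega>"
  using minimizes_step by (simp add: is_arg_min_linorder)

lemma step_le: "z \<in> \<Omega> \<Longrightarrow> surrogate (step x) x \<le> surrogate z x"
  using minimizes_step by (simp add: is_arg_min_linorder)

lemma step_eqI: "y \<in> \<Omega> \<Longrightarrow> (\<And>z. z \<in> \<Omega> \<Longrightarrow> surrogate y x \<le> surrogate z x) \<Longrightarrow> step x = y"
  by (rule minimizes_unique[OF minimizes_step]) (simp add: is_arg_min_linorder)

text \<open>On a compact ball the minimizers stay bounded, so the closed graph theorem applies.\<close>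

lemma continuous_on_step: "continuous_on S step"
proof -
  have local: "continuous_on (cball a 1) step" for a
  proof -
    obtain i where i: "i \<in> I" using ne by auto
    obtain y0 where y0: "y0 \<in> \<Omega>" using \<Omega> by auto
    have "compact ((\<lambda>x. surrogate y0 x) ` cball a 1)"
      by (intro compact_continuous_image continuous_intros) auto
    then have "bdd_above ((\<lambda>x. surrogate y0 x) ` cball a 1)"
      by (intro bounded_imp_bdd_above compact_imp_bounded)
    then obtain M where M: "\<And>x. x \<in> cball a 1 \<Longrightarrow> surrogate y0 x \<le> M"
      by (auto simp only: bdd_above_def ball_simps)
    \<comment> \<open>\<open>p * M\<close> bounds the distance from \<open>step x\<close> to the
      projection of \<open>x\<close>; the extra 1 covers the shift of that projection, which is
      nonexpansive, over the unit ball.\<close>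
    define K where "K = cball (closest_point (T i) a) (p * M + 1)"
    have stepK: "step x \<in> K" if x: "x \<in> cball a 1" for x
    proof -
      have "p * surrogate (step x) x \<le> p * M"
        using step_le[OF y0, of x] M[OF x] p by simp
      then have "dist (closest_point (T i) x) (step x) \<le> p * M"
        using norm_le_surrogate[OF i, of "step x" x] by (simp add: dist_norm norm_minus_commute)
      moreover have "dist (closest_point (T i) a) (closest_point (T i) x) \<le> 1"
        using closest_point_lipschitz[of "T i" a x] T[OF i] x by simp
      ultimately show ?thesis
        using dist_triangle[of "closest_point (T i) a" "step x" "closest_point (T i) x"]
        by (simp add: K_def)
    qed
    \<comment> \<open>One closed condition per competitor \<open>z\<close>; uniqueness of the
      minimizer makes these conditions characterize the graph.\<close>
    have graph: "(\<lambda>x. (x, step x)) ` cball a 1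
        = (cball a 1 \<times> \<Omega>) \<inter> (\<Inter>z\<in>\<Omega>. {q. surrogate (snd q) (fst q) \<le> surrogate z (fst q)})"
      (is "?G = ?H")
    proof
      show "?G \<subseteq> ?H"
        using step_in step_le by auto
      show "?H \<subseteq> ?G"
      proof
        fix q assume q: "q \<in> ?H"
        then have "step (fst q) = snd q"
          by (intro step_eqI) auto
        then show "q \<in> ?G"
          using q by (intro image_eqI[of _ _ "fst q"]) auto
      qed
    qed
    have "closed {q. surrogate (snd q) (fst q) \<le> surrogate z (fst q)}" for z
      by (intro closed_Collect_le continuous_intros)
    then have "closed ((\<lambda>x. (x, step x)) ` cball a 1)"
      unfolding graph using \<Omega> by (intro closed_Int closed_Times closed_INT) auto
    then show ?thesis
      using stepK by (intro continuous_from_closed_graph[of K]) (auto simp: K_def)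
  qed
  have "isCont step a" for a
    using local[of a] by (rule continuous_on_interior) simp
  then show ?thesis
    by (simp add: continuous_at_imp_continuous_on)
qed

section \<open>Compact level sets, descent and fixed points\<close>

lemma compact_sublevel:
  assumes "bounded \<Omega> \<or> (\<exists>i\<in>I. bounded (T i))"
  shows "compact {x \<in> \<Omega>. energy x \<le> c}"
proof -
  let ?L = "{x \<in> \<Omega>. energy x \<le> c}"
  have "closed ?L"
    unfolding Collect_conj_eq using \<Omega>
    by (intro closed_Int closed_Collect_le continuous_on_energy continuous_intros) auto
  moreover have "bounded ?L"
    using assms
  proof
    assume "bounded \<Omega>"
    then show ?thesis by (rule bounded_subset) auto
  next
    assume "\<exists>i\<in>I. bounded (T i)"
    then obtain i where i: "i \<in> I" and "bounded (T i)" by auto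
    then have "compact (T i)"
      using T by (simp add: compact_eq_bounded_closed)
    \<comment> \<open>As \<open>c\<close> is arbitrary, \<open>max 1\<close> keeps the radius
      positive for \<open>compact_infdist_le\<close>.\<close>
    have "infdist x (T i) \<le> max 1 (p * c)" if "x \<in> ?L" for x
    proof -
      have "p * energy x \<le> p * c"
        using that p by simp
      then show ?thesis
        using norm_le_surrogate[OF i, of x x] T[OF i]
        by (simp add: infdist_eq_dist_closest_point energy_def)
    qed
    then have "?L \<subseteq> {x. infdist x (T i) \<le> max 1 (p * c)}"
      by blast
    have "compact {x. infdist x (T i) \<le> max 1 (p * c)}"
      using T(1)[OF i] \<open>compact (T i)\<close> by (intro compact_infdist_le) auto
    from this \<open>?L \<subseteq> _\<close> show ?thesis
      by (rule bounded_subset[OF compact_imp_bounded])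
  qed
  ultimately show ?thesis
    by (simp add: compact_eq_bounded_closed)
qed

text \<open>If the surrogate did not drop strictly, \<open>x\<close> would itself be a minimizer and
  hence equal \<open>step x\<close>; majorization carries the drop over to the energy.\<close>

lemma energy_step_less:
  assumes "x \<in> \<Omega>" "x \<noteq> step x"
  shows "energy (step x) < energy x"
proof -
  have "surrogate (step x) x \<noteq> surrogate x x"
    using assms step_eqI[of x x] step_le[of _ x] by metis
  then have "surrogate (step x) x < energy x"
    using step_le[OF assms(1), of x] by (simp add: energy_def)
  then show ?thesis
    using energy_le_surrogate[of "step x" x] by linarith
qed

text \<open>Energy and surrogate agree up to second order at the base point. Hence near a fixed point
  \<^term>\<open>x\<close> the energy drops below \<^term>\<open>energy x\<close> at most quadratically along a segment in
  \<^term>\<open>\<Omega>\<close>, whereas by convexity a better point would force a linear decrease.\<close>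

lemma fixed_point_minimizes:
  assumes x: "x \<in> \<Omega>" and fixp: "step x = x" and z: "z \<in> \<Omega>"
  shows "energy x \<le> energy z"
proof (rule ccontr)
  assume "\<not> energy x \<le> energy z"
  define \<delta> where "\<delta> = energy x - energy z"
  have \<delta>: "\<delta> > 0"
    using \<open>\<not> energy x \<le> energy z\<close> by (simp add: \<delta>_def)
  \<comment> \<open>The coefficient of \<open>t^2\<close> in the loss of
    \<open>surrogate_le_energy\<close> at the point \<open>x + t (z - x)\<close>.\<close>
  define C where "C = (norm (z - x))\<^sup>2 / (2 * p\<^sup>2)"
  have C: "C \<ge> 0" by (simp add: C_def)
  have key: "\<delta> \<le> energy x * C * t" if t: "0 < t" "t < 1" "C * t \<le> 1" for t
  proof -
    define w where "w = (1 - t) *\<^sub>R x + t *\<^sub>R z"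
    have w: "w \<in> \<Omega>"
      unfolding w_def using \<Omega> x z t by (intro convexD) auto
    have wx: "w - x = t *\<^sub>R (z - x)"
      by (simp add: w_def algebra_simps)
    have quot: "(norm (w - x))\<^sup>2 / (2 * p\<^sup>2) = C * t * t"
      by (simp add: wx C_def power2_eq_square)
    \<comment> \<open>Keeps the factor \<open>1 - C * t * t\<close> nonnegative, so the minimality
      of \<open>x\<close> can be multiplied by it.\<close>
    have "C * t * t \<le> 1"
      using mult_mono[of "C * t" 1 t 1] t C by simp
    then have "energy x * (1 - C * t * t) \<le> surrogate w x * (1 - C * t * t)"
      using step_le[OF w, of x] by (intro mult_right_mono) (auto simp: fixp energy_def)
    also have "\<dots> \<le> energy w"
      using surrogate_le_energy[of w x] by (simp add: quot)
    also have "\<dots> \<le> (1 - t) * energy x + t * energy z"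
      unfolding w_def using t by (intro energy_convex) auto
    also have "\<dots> = energy x - t * \<delta>"
      by (simp add: \<delta>_def algebra_simps)
    finally have "t * \<delta> \<le> t * (energy x * C * t)"
      by (simp add: algebra_simps)
    then show ?thesis
      using t by simp
  qed
  \<comment> \<open>The bound in \<open>key\<close> vanishes as \<open>t\<close> tends to 0, while
    \<open>\<delta>\<close> is a fixed positive number.\<close>
  have "\<forall>\<^sub>F t in at_right 0. (0::real) < t \<and> t < 1 \<and> C * t < 1 \<and> energy x * C * t < \<delta>"
  proof (intro eventually_conj)
    have "((\<lambda>t. C * t) \<longlongrightarrow> C * 0) (at_right 0)" "((\<lambda>t. energy x * C * t) \<longlongrightarrow> energy x * C * 0) (at_right 0)"
      by (intro tendsto_intros)+
    then show "\<forall>\<^sub>F t in at_right 0. C * t < 1" "\<forall>\<^sub>F t in at_right 0. energy x * C * t < \<delta>"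
      using \<delta> by (auto intro: order_tendstoD)
  qed (auto simp: eventually_at_right_less eventually_at_right_field intro!: exI[of _ 1])
  then obtain t where "0 < t" "t < 1" "C * t < 1" "energy x * C * t < \<delta>"
    using eventually_happens[of _ "at_right (0::real)"] by auto
  with key[of t] show False by simp
qed

end

theorem theorem4p4:
  fixes \<Omega> :: "(real ^ 'n) set"
    and T :: "nat \<Rightarrow> (real ^ 'n) set"
    and m :: nat
    and p :: real
  assumes "m \<ge> 1"
    and "\<Omega> \<noteq> {}" and "closed \<Omega>" and "convex \<Omega>"
    and "\<And>i. i \<in> {1..m} \<Longrightarrow> T i \<noteq> {} \<and> closed (T i) \<and> convex (T i)"
    and "bounded \<Omega> \<or> (\<exists>i\<in>{1..m}. bounded (T i))"
    and "p > 0"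
  shows "(\<forall>x\<in>\<Omega>. \<exists>!y. is_arg_min (\<lambda>y. smooth_major m T y x p) (\<lambda>y. y \<in> \<Omega>) y)
    \<and> alg_map \<Omega> m T p \<in> \<Omega> \<rightarrow> \<Omega>
    \<and> (\<forall>x0\<in>\<Omega>. compact {x \<in> \<Omega>. smooth_dist m T x p \<le> smooth_dist m T x0 p})
    \<and> continuous_on \<Omega> (alg_map \<Omega> m T p)
    \<and> (\<forall>x\<in>\<Omega>. x \<noteq> alg_map \<Omega> m T p x \<longrightarrow>
          smooth_dist m T (alg_map \<Omega> m T p x) p < smooth_dist m T x p)
    \<and> (\<forall>xbar\<in>\<Omega>. alg_map \<Omega> m T p xbar = xbar \<longrightarrow>
          is_arg_min (\<lambda>x. smooth_dist m T x p) (\<lambda>x. x \<in> \<Omega>) xbar)"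
proof -
  interpret smoothed_targets \<Omega> "{1..m}" T p
    using assms by unfold_locales auto
  \<comment> \<open>Both functions are \<open>p * ln\<close> of a positive quantity, so minimizers
    and inequalities transfer unchanged.\<close>
  have major: "smooth_major m T y x p = p * ln (surrogate y x)" for x y
    unfolding smooth_major_def surrogate_def pen_def ..
  have dist: "smooth_dist m T x p = p * ln (energy x)" for x
    unfolding smooth_dist_def energy_def surrogate_def pen_def
    using T by (simp add: infdist_eq_dist_closest_point)
  have min_iff: "is_arg_min (\<lambda>y. smooth_major m T y x p) (\<lambda>y. y \<in> \<Omega>) y = minimizes x y" for x y
    unfolding is_arg_min_linorder major using p surrogate_pos by simp
  have alg: "alg_map \<Omega> m T p = step"
    unfolding alg_map_def step_def min_iff ..
  have dist_le: "smooth_dist m T x p \<le> smooth_dist m T y p \<longleftrightarrow> energy x \<le> energy y" for x y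
    using p energy_pos[of x] energy_pos[of y] unfolding dist by simp
  have dist_less: "smooth_dist m T x p < smooth_dist m T y p \<longleftrightarrow> energy x < energy y" for x y
    using p energy_pos[of x] energy_pos[of y] unfolding dist by simp
  show ?thesis
    unfolding alg min_iff dist_le dist_less
  proof (intro conjI ballI impI)
    show "\<exists>!y. minimizes x y" for x
      using minimizes_ex minimizes_unique by blast
    show "step \<in> \<Omega> \<rightarrow> \<Omega>"
      using step_in by simp
    show "compact {x \<in> \<Omega>. energy x \<le> energy x0}" for x0
      using assms(6) by (rule compact_sublevel)
    show "continuous_on \<Omega> step"
      by (rule continuous_on_step)
    show "energy (step x) < energy x" if "x \<in> \<Omega>" "x \<noteq> step x" for x
      using that by (rule energy_step_less)
    show "is_arg_min (\<lambda>x. smooth_dist m T x p) (\<lambda>x. x \<in> \<Omega>) xbar"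
      if "xbar \<in> \<Omega>" "step xbar = xbar" for xbar
      using fixed_point_minimizes[OF that] that by (simp add: is_arg_min_linorder dist_le)
  qed
qed

end
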